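(* The multiset of hooks of a Young diagram does not determine the Ehrhart polynomial of the associated order polytope: for the partitions $\lambda=(8,5,4)$ and $\mu=(7,7,2,1)$, the multisets of hook values of $\lambda$ and of $\mu$ are equal, but the Ehrhart polynomials of the order polytopes $\mathcal{O}(P_\lambda)$ and $\mathcal{O}(P_\mu)$ are different.
   Context: For a finite poset $P$ on $[n]=\{1,\dots,n\}$, the order polytope $\mathcal{O}(P)\subset\mathbb{R}^n$ is defined by the inequalities $x_i\le x_j$ whenever $i<_P j$, and $0\le x_i\le 1$ for $1\le i\le n$. (It has integer vertices.) For a partition $\lambda$, $P_\lambda$ is the poset whose elements are the boxes $(i,j)$ of the Young diagram of $\lambda$ (i.e. $1\le j\le\lambda_i$), ordered by $(i,j)\le(i',j')$ iff $i\le i'$ and $j\le j'$. The hook value of the box $(i,j)\in\lambda$ is $\mathrm{hook}_\lambda((i,j))=\lambda_i+\lambda'_j-i-j+1$, where $\lambda'$ is the conjugate partition; the multiset of hooks of $\lambda$ is the multiset of these values over all boxes of $\lambda$. For a polytope $\mathcal{P}\subset\mathbb{R}^n$ with integer vertices, the Ehrhart polynomial is the polynomial $\mathrm{ehr}_{\mathcal{P}}$ with $\mathrm{ehr}_{\mathcal{P}}(k)=\#(k\mathcal{P}\cap\mathbb{Z}^n)$ for all positive integers $k$. *)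

theory Defs
  imports Complex_Main "HOL-Library.Multiset" "HOL-Computational_Algebra.Polynomial"
begin

text \<open>
  A finite poset is given by its carrier \<open>A\<close> and its (reflexive) order relation \<open>r\<close>, as in
  \<^const>\<open>partial_order_on\<close>. Its coordinates are indexed by \<open>A\<close> itself rather than by a
  labelling of \<open>A\<close> with \<open>{1..n}\<close>; the space \<open>\<real>\<^sup>A\<close> is represented by the functions that
  vanish outside \<open>A\<close>.
\<close>

definition order_polytope :: "'a set \<Rightarrow> 'a rel \<Rightarrow> ('a \<Rightarrow> real) set" where
  "order_polytope A r = {x. (\<forall>a. a \<notin> A \<longrightarrow> x a = 0)
     \<and> (\<forall>a b. (a, b) \<in> r \<and> a \<noteq> b \<longrightarrow> x a \<le> x b)
     \<and> (\<forall>a\<in>A. 0 \<le> x a \<and> x a \<le> 1)}"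

definition dilate :: "nat \<Rightarrow> ('a \<Rightarrow> real) set \<Rightarrow> ('a \<Rightarrow> real) set" where
  "dilate k P = (\<lambda>x a. real k * x a) ` P"

definition lattice_points :: "('a \<Rightarrow> real) set" where
  "lattice_points = {x. \<forall>a. x a \<in> \<int>}"

definition is_ehrhart_polynomial :: "('a \<Rightarrow> real) set \<Rightarrow> real poly \<Rightarrow> bool" where
  "is_ehrhart_polynomial P p \<longleftrightarrow>
     (\<forall>k::nat. k > 0 \<longrightarrow> poly p (real k) = real (card (dilate k P \<inter> lattice_points)))"

text \<open>There is at most one such polynomial; for lattice polytopes it exists by Ehrhart's theorem.\<close>

definition ehrhart_polynomial :: "('a \<Rightarrow> real) set \<Rightarrow> real poly" where
  "ehrhart_polynomial P = (THE p. is_ehrhart_polynomial P p)"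

text \<open>Partitions are weakly decreasing lists of positive parts; parts are indexed from 1.\<close>

definition is_partition :: "nat list \<Rightarrow> bool" where
  "is_partition l \<longleftrightarrow> sorted_wrt (\<ge>) l \<and> (\<forall>m\<in>set l. m > 0)"

definition part :: "nat list \<Rightarrow> nat \<Rightarrow> nat" where
  "part l i = (if 1 \<le> i \<and> i \<le> length l then l ! (i - 1) else 0)"

definition young_diagram :: "nat list \<Rightarrow> (nat \<times> nat) set" where
  "young_diagram l = {(i, j). 1 \<le> i \<and> 1 \<le> j \<and> j \<le> part l i}"

definition conj_part :: "nat list \<Rightarrow> nat \<Rightarrow> nat" where
  "conj_part l j = card {i. 1 \<le> i \<and> i \<le> length l \<and> j \<le> part l i}"

definition young_order :: "nat list \<Rightarrow> (nat \<times> nat) rel" where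
  "young_order l = {((i, j), (i', j')). (i, j) \<in> young_diagram l \<and> (i', j') \<in> young_diagram l
     \<and> i \<le> i' \<and> j \<le> j'}"

fun hook :: "nat list \<Rightarrow> nat \<times> nat \<Rightarrow> int" where
  "hook l (i, j) = int (part l i) + int (conj_part l j) - int i - int j + 1"

definition hook_multiset :: "nat list \<Rightarrow> int multiset" where
  "hook_multiset l = image_mset (hook l) (mset_set (young_diagram l))"

lemma finite_young_diagram: "finite (young_diagram l)"
proof -
  have "young_diagram l \<subseteq> (\<Union>i\<in>{1..length l}. {i} \<times> {1..part l i})"
    by (auto simp: young_diagram_def part_def split: if_splits)
  then show ?thesis
    by (rule finite_subset) auto
qed

lemma partial_order_young_order: "partial_order_on (young_diagram l) (young_order l)"
  by (auto simp: partial_order_on_def preorder_on_def refl_on_def trans_def antisym_def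
      young_order_def)

lemma is_partition_examples: "is_partition [8, 5, 4]" "is_partition [7, 7, 2, 1]"
  by (auto simp: is_partition_def)

end

theory Submission
  imports Defs "HOL-Library.FuncSet"
begin

text \<open>
  Grouping the order-preserving maps from a finite poset to the chain \<open>{0..k}\<close> by their image
  exhibits their number as a combination of the polynomials \<open>binomial (k + 1) m\<close>, so the Ehrhart
  polynomial exists. Its value at 1 is the number of order ideals, which for \<open>P\<^sub>\<lambda>\<close> is the number
  of Young diagrams contained in \<open>\<lambda>\<close>: 115 for (8,5,4) but 134 for (7,7,2,1).
\<close>

section \<open>Lattice points of dilated order polytopes as order-preserving maps\<close>

text \<open>Extensional functions make this set finite when \<open>A\<close> and \<open>T\<close>
  are. The target is an arbitrary \<open>T\<close>, not just a chain \<open>{..k}\<close>, because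
  maps will be sorted by their images.\<close>

definition order_maps :: "'a set \<Rightarrow> 'a rel \<Rightarrow> nat set \<Rightarrow> ('a \<Rightarrow> nat) set" where
  "order_maps A r T = {f \<in> A \<rightarrow>\<^sub>E T. \<forall>(a, b)\<in>r. f a \<le> f b}"

lemma finite_order_maps: "finite A \<Longrightarrow> finite T \<Longrightarrow> finite (order_maps A r T)"
  by (simp add: order_maps_def finite_PiE)

text \<open>Dilation by \<open>k\<close> turns the bounds 0 and 1 into 0 and \<open>k\<close> and
  keeps the inequalities between coordinates, so the integer points are exactly the order-preserving
  maps to \<open>{0..k}\<close>.\<close>

lemma card_lattice_points_order_polytope:
  assumes r: "r \<subseteq> A \<times> A" and k: "k > 0"
  shows "card (dilate k (order_polytope A r) \<inter> lattice_points) = card (order_maps A r {..k})"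
proof -
  \<comment> \<open>\<open>h\<close> translates between two conventions: maps are
    \<open>undefined\<close> outside \<open>A\<close>, points of the polytope are 0 there.\<close>
  define h :: "('a \<Rightarrow> nat) \<Rightarrow> 'a \<Rightarrow> real" where "h f a = (if a \<in> A then real (f a) else 0)" for f a
  have "inj_on h (order_maps A r {..k})"
  proof (rule inj_onI)
    fix f g assume f: "f \<in> order_maps A r {..k}" and g: "g \<in> order_maps A r {..k}" and eq: "h f = h g"
    have "f a = g a" if "a \<in> A" for a
      using fun_cong[OF eq, of a] that by (simp add: h_def)
    then show "f = g"
      using f g by (intro PiE_ext[of f A "\<lambda>_. {..k}"]) (auto simp: order_maps_def)
  qed
  moreover have "h ` order_maps A r {..k} = dilate k (order_polytope A r) \<inter> lattice_points"
  proof (intro equalityI subsetI)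
    fix y assume "y \<in> h ` order_maps A r {..k}"
    then obtain f where f: "f \<in> order_maps A r {..k}" and y: "y = h f" by blast
    have "(\<lambda>a. h f a / k) \<in> order_polytope A r"
      using f r k by (fastforce simp: order_polytope_def order_maps_def h_def field_simps PiE_iff)
    moreover have "y = (\<lambda>a. real k * (h f a / k))"
      using k y by auto
    ultimately have "y \<in> dilate k (order_polytope A r)"
      unfolding dilate_def by (intro image_eqI[of _ _ "\<lambda>a. h f a / k"])
    then show "y \<in> dilate k (order_polytope A r) \<inter> lattice_points"
      by (simp add: lattice_points_def y h_def)
  next
    fix y assume "y \<in> dilate k (order_polytope A r) \<inter> lattice_points"
    then obtain x where x: "x \<in> order_polytope A r" and y: "y = (\<lambda>a. real k * x a)"
      and int: "\<And>a. y a \<in> \<int>"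
      by (auto simp: dilate_def lattice_points_def)
    \<comment> \<open>Rounding loses nothing, since \<open>y\<close> takes nonnegative integer
      values on \<open>A\<close>; the restriction to \<open>A\<close> makes \<open>f\<close>
      extensional.\<close>
    define f where "f = (\<lambda>a\<in>A. nat \<lfloor>y a\<rfloor>)"
    have y_eq: "real (nat \<lfloor>y a\<rfloor>) = y a" if "a \<in> A" for a
    proof -
      have "0 \<le> y a" using x that by (auto simp: y order_polytope_def)
      then show ?thesis using int[of a] by (auto elim!: Ints_cases)
    qed
    have "y a = 0" if "a \<notin> A" for a
      using x that by (simp add: y order_polytope_def)
    then have "y = h f"
      using y_eq by (simp add: h_def f_def fun_eq_iff)
    moreover have "f \<in> order_maps A r {..k}"
    proof -
      have "f a \<le> k" if "a \<in> A" for a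
      proof -
        have "y a \<le> k" using x that by (simp add: y order_polytope_def mult_left_le)
        then show ?thesis using y_eq[OF that] that by (simp add: f_def)
      qed
      moreover have "f a \<le> f b" if "(a, b) \<in> r" for a b
      proof -
        have "a \<in> A" "b \<in> A" using r that by auto
        moreover have "y a \<le> y b"
          using x that by (cases "a = b") (simp_all add: y order_polytope_def mult_left_mono)
        ultimately show ?thesis by (simp add: f_def nat_mono floor_mono)
      qed
      moreover have "f \<in> extensional A" by (simp add: f_def)
      ultimately show ?thesis by (auto simp: order_maps_def PiE_iff)
    qed
    ultimately show "y \<in> h ` order_maps A r {..k}" by (rule image_eqI)
  qed
  ultimately show ?thesis
    by (metis card_image)
qed

section \<open>Counting order-preserving maps by their image\<close>

definition surj_order_maps :: "'a set \<Rightarrow> 'a rel \<Rightarrow> nat set \<Rightarrow> ('a \<Rightarrow> nat) set" where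
  "surj_order_maps A r T = {f \<in> order_maps A r T. f ` A = T}"

text \<open>Being order-preserving depends only on comparisons of values, so composing with the
  increasing bijection between \<open>T\<close> and \<open>{..<card T}\<close>, in either direction,
  preserves it.\<close>

lemma card_surj_order_maps_cong:
  assumes r: "r \<subseteq> A \<times> A" and T: "finite T"
  shows "card (surj_order_maps A r T) = card (surj_order_maps A r {..<card T})"
proof -
  obtain h where h: "bij_betw h {..<card T} T" and mono: "strict_mono_on {..<card T} h"
    using ex_bij_betw_strict_mono_card[OF T] by metis
  define g where "g = inv_into {..<card T} h"
  have g: "bij_betw g T {..<card T}"
    unfolding g_def by (rule bij_betw_inv_into[OF h])
  have hg: "h (g t) = t" if "t \<in> T" for t
    unfolding g_def using that h by (auto simp: bij_betw_def f_inv_into_f)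
  have gh: "g (h t) = t" if "t < card T" for t
    unfolding g_def using that h by (auto simp: bij_betw_def inv_into_f_f)
  \<comment> \<open>The inverse of a strictly increasing map on a chain is increasing: a reversed
    pair would be reversed again by \<open>h\<close>.\<close>
  have g_le: "g s \<le> g t" if "s \<le> t" "s \<in> T" "t \<in> T" for s t
  proof (rule ccontr)
    assume "\<not> g s \<le> g t"
    then have "h (g t) < h (g s)"
      using that g mono by (intro strict_mono_onD[OF mono]) (auto simp: bij_betw_def)
    then show False using that hg by simp
  qed
  have h_le: "h s \<le> h t" if "s \<le> t" "t < card T" for s t
    using that strict_mono_onD[OF mono, of s t] by (cases "s = t") auto
  have hT: "h ` {..<card T} = T" and gT: "g ` T = {..<card T}"
    using h g by (auto simp: bij_betw_def)
  have "bij_betw (\<lambda>f. \<lambda>a\<in>A. g (f a)) (surj_order_maps A r T) (surj_order_maps A r {..<card T})"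
  proof (rule bij_betwI[where g = "\<lambda>f. \<lambda>a\<in>A. h (f a)"], goal_cases)
    case 1
    show ?case
    proof
      fix f assume "f \<in> surj_order_maps A r T"
      then have f: "f ` A = T" "\<And>a b. (a, b) \<in> r \<Longrightarrow> f a \<le> f b"
        by (auto simp: surj_order_maps_def order_maps_def)
      have "(\<lambda>a. g (f a)) ` A = {..<card T}" using f(1) gT by (simp flip: image_image)
      moreover have "g (f a) \<le> g (f b) \<and> a \<in> A \<and> b \<in> A" if "(a, b) \<in> r" for a b
        using that r f by (auto intro!: g_le)
      ultimately show "(\<lambda>a\<in>A. g (f a)) \<in> surj_order_maps A r {..<card T}"
        by (auto simp: surj_order_maps_def order_maps_def)
    qed
  next
    case 2
    show ?case
    proof
      fix f assume "f \<in> surj_order_maps A r {..<card T}"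
      then have f: "f ` A = {..<card T}" "\<And>a b. (a, b) \<in> r \<Longrightarrow> f a \<le> f b"
        by (auto simp: surj_order_maps_def order_maps_def)
      have "(\<lambda>a. h (f a)) ` A = T" using f(1) hT by (simp flip: image_image)
      moreover have "h (f a) \<le> h (f b) \<and> a \<in> A \<and> b \<in> A" if "(a, b) \<in> r" for a b
        using that r f by (auto intro!: h_le)
      ultimately show "(\<lambda>a\<in>A. h (f a)) \<in> surj_order_maps A r T"
        by (auto simp: surj_order_maps_def order_maps_def)
    qed
  next
    case (3 f)
    then show ?case
      by (intro extensionalityI[of _ A])
        (auto simp: surj_order_maps_def order_maps_def PiE_iff hg)
  next
    case (4 f)
    then show ?case
      by (intro extensionalityI[of _ A])
        (auto simp: surj_order_maps_def order_maps_def PiE_iff gh)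
  qed
  then show ?thesis by (rule bij_betw_same_card)
qed

text \<open>Every map is surjective onto its image \<open>T\<close>, the number of such maps depends
  only on \<open>card T\<close>, and \<open>{0..k}\<close> has \<open>Suc k choose m\<close> subsets
  of size \<open>m\<close>. The range of summation is independent of \<open>k\<close>, so the
  right-hand side is a polynomial in \<open>k\<close>.\<close>

lemma card_order_maps:
  assumes A: "finite A" and r: "r \<subseteq> A \<times> A"
  shows "card (order_maps A r {..k})
    = (\<Sum>m\<le>card A. card (surj_order_maps A r {..<m}) * (Suc k choose m))"
proof -
  define N where "N m = card (surj_order_maps A r {..<m})" for m
  have fin: "finite (surj_order_maps A r T)" if "finite T" for T
    using that A by (simp add: surj_order_maps_def finite_order_maps)
  have N0: "N m = 0" if "m > card A" for m
  proof -
    have "f ` A \<noteq> {..<m}" for f :: "'a \<Rightarrow> nat"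
      using that card_image_le[OF A, of f] by auto
    then have "surj_order_maps A r {..<m} = {}"
      by (simp add: surj_order_maps_def)
    then show ?thesis by (simp add: N_def)
  qed
  have fin_T: "finite T" if "T \<in> Pow {..k}" for T
    using that finite_subset[of T "{..k}"] by simp
  have "order_maps A r {..k} = (\<Union>T\<in>Pow {..k}. surj_order_maps A r T)"
    by (fastforce simp: surj_order_maps_def order_maps_def)
  moreover have "surj_order_maps A r S \<inter> surj_order_maps A r T = {}" if "S \<noteq> T" for S T
    using that by (auto simp: surj_order_maps_def)
  ultimately have "card (order_maps A r {..k}) = (\<Sum>T\<in>Pow {..k}. card (surj_order_maps A r T))"
    by (simp add: card_UN_disjoint fin fin_T)
  also have "\<dots> = (\<Sum>T\<in>Pow {..k}. N (card T))"
    by (intro sum.cong refl) (simp add: N_def card_surj_order_maps_cong[OF r fin_T])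
  also have "\<dots> = (\<Sum>m\<le>Suc k. \<Sum>T\<in>{T \<in> Pow {..k}. card T = m}. N (card T))"
    by (rule sum.group[symmetric]) (use card_mono[of "{..k}"] in force)+
  also have "\<dots> = (\<Sum>m\<le>Suc k. N m * (Suc k choose m))"
    by (rule sum.cong) (auto simp: n_subsets Pow_def)
  \<comment> \<open>The range is first enlarged by terms whose binomial coefficient is 0, then cut
    down to \<open>card A\<close>, above which there are no surjections.\<close>
  also have "\<dots> = (\<Sum>m\<le>max (Suc k) (card A). N m * (Suc k choose m))"
    by (rule sum.mono_neutral_left) (auto simp: binomial_eq_0)
  also have "\<dots> = (\<Sum>m\<le>card A. N m * (Suc k choose m))"
    by (rule sum.mono_neutral_right) (auto simp: N0)
  finally show ?thesis by (simp add: N_def)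
qed

section \<open>Existence and uniqueness of the Ehrhart polynomial\<close>

text \<open>This is \<open>x + 1\<close> choose \<open>m\<close> as a polynomial in
  \<open>x\<close>; the shift by one reflects that \<open>{0..k}\<close> has \<open>k + 1\<close>
  elements.\<close>

definition binomial_poly :: "nat \<Rightarrow> real poly" where
  "binomial_poly m = smult (1 / fact m) (\<Prod>i<m. [:1 - real i, 1:])"

lemma poly_binomial_poly: "poly (binomial_poly m) (real k) = real (Suc k choose m)"
  by (simp add: binomial_poly_def binomial_gbinomial gbinomial_prod_rev poly_prod
      atLeast0LessThan algebra_simps)

text \<open>The difference of two such polynomials vanishes at all positive integers, but a nonzero
  polynomial has only finitely many roots.\<close>

lemma is_ehrhart_polynomial_unique:
  assumes "is_ehrhart_polynomial P p" "is_ehrhart_polynomial P q"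
  shows "p = q"
proof (rule ccontr)
  assume "p \<noteq> q"
  then have "finite {x. poly (p - q) x = 0}"
    by (intro poly_roots_finite) simp
  moreover have "real ` {0<..} \<subseteq> {x. poly (p - q) x = 0}"
    using assms by (auto simp: is_ehrhart_polynomial_def)
  ultimately have "finite (real ` {0<..})"
    by (rule finite_subset[rotated])
  then show False
    by (simp add: finite_image_iff infinite_Ioi)
qed

text \<open>The description by \<open>THE\<close> denotes something only once existence is known;
  the count by images supplies an explicit witness.\<close>

lemma is_ehrhart_polynomial_ehrhart_polynomial:
  assumes A: "finite A" and r: "r \<subseteq> A \<times> A"
  shows "is_ehrhart_polynomial (order_polytope A r) (ehrhart_polynomial (order_polytope A r))"
proof -
  define p where
    "p = (\<Sum>m\<le>card A. smult (real (card (surj_order_maps A r {..<m}))) (binomial_poly m))"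
  have "is_ehrhart_polynomial (order_polytope A r) p"
    by (simp add: is_ehrhart_polynomial_def card_lattice_points_order_polytope[OF r]
        card_order_maps[OF A r] p_def poly_sum poly_binomial_poly del: binomial_Suc_Suc)
  then have "\<exists>!p. is_ehrhart_polynomial (order_polytope A r) p"
    using is_ehrhart_polynomial_unique by blast
  then show ?thesis
    unfolding ehrhart_polynomial_def by (rule theI')
qed

text \<open>One differing value separates two polynomials. At 1 the value counts maps to
  \<open>{0, 1}\<close>, which correspond to order ideals via their zero sets.\<close>

lemma poly_ehrhart_polynomial_1:
  assumes "finite A" and r: "r \<subseteq> A \<times> A"
  shows "poly (ehrhart_polynomial (order_polytope A r)) 1 = real (card (order_maps A r {..1}))"
  using is_ehrhart_polynomial_ehrhart_polynomial[OF assms] card_lattice_points_order_polytope[OF r, of 1]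
  by (auto simp: is_ehrhart_polynomial_def dest: spec[of _ 1])

section \<open>Order ideals of a Young diagram as subpartitions\<close>

text \<open>Row lengths are padded with zeros to the length of \<open>l\<close>, so these lists need
  not satisfy \<open>is_partition\<close>.\<close>

definition subpartitions :: "nat list \<Rightarrow> nat list set" where
  "subpartitions l = {z. list_all2 (\<le>) z l \<and> sorted_wrt (\<ge>) z}"

text \<open>The zero set of an order-preserving map to \<open>{0, 1}\<close> is closed downwards, so
  each of its rows is an initial segment and the row lengths decrease weakly.\<close>

lemma card_order_maps_young:
  assumes l: "sorted_wrt (\<ge>) l"
  shows "card (order_maps (young_diagram l) (young_order l) {..1}) = card (subpartitions l)"
proof -
  define Y where "Y = young_diagram l"
  define h :: "nat list \<Rightarrow> nat \<times> nat \<Rightarrow> nat"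
    where "h z = (\<lambda>(i, j)\<in>Y. if j \<le> part z i then 0 else 1)" for z
  have part_le: "part z i \<le> part l i" if "z \<in> subpartitions l" for z i
    using that by (auto simp: subpartitions_def part_def list_all2_conv_all_nth)
  have part_anti: "part z i' \<le> part z i" if "z \<in> subpartitions l" "1 \<le> i" "i \<le> i'" for z i i'
    using that sorted_wrt_nth_less[of "(\<ge>)" z "i - 1" "i' - 1"]
    by (cases "i = i'") (auto simp: subpartitions_def part_def)
  have "inj_on h (subpartitions l)"
  proof (rule inj_onI)
    fix z w assume z: "z \<in> subpartitions l" and w: "w \<in> subpartitions l" and eq: "h z = h w"
    have len: "length z = length l" "length w = length l"
      using z w by (auto simp: subpartitions_def list_all2_conv_all_nth)
    \<comment> \<open>The last box of row \<open>i\<close> of \<open>z\<close> has value 0 under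
      \<open>h z\<close>, hence under \<open>h w\<close>, so it lies in the diagram of
      \<open>w\<close> as well.\<close>
    have le: "part z i \<le> part w i"
      if z: "z \<in> subpartitions l" and eq: "h z = h w" and "1 \<le> i" for z w i
    proof (cases "part z i = 0")
      case False
      then have "(i, part z i) \<in> Y"
        using that part_le[OF z] by (auto simp: Y_def young_diagram_def)
      then show ?thesis using fun_cong[OF eq, of "(i, part z i)"] by (auto simp: h_def split: if_splits)
    qed simp
    have "part z (Suc i) = part w (Suc i)" for i
      using le[OF z eq] le[OF w eq[symmetric]] by (simp add: le_antisym)
    moreover have "part u (Suc i) = u ! i" if "i < length u" for u i
      using that by (simp add: part_def)
    ultimately have "z ! i = w ! i" if "i < length l" for i
      using that len by metis
    then show "z = w"
      using len by (intro nth_equalityI) simp_all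
  qed
  moreover have "h ` subpartitions l = order_maps Y (young_order l) {..1}"
  proof (intro equalityI subsetI)
    fix f assume "f \<in> h ` subpartitions l"
    then obtain z where z: "z \<in> subpartitions l" and f: "f = h z" by blast
    show "f \<in> order_maps Y (young_order l) {..1}"
      using part_anti[OF z]
      by (fastforce simp: f h_def order_maps_def young_order_def Y_def young_diagram_def)
  next
    fix f assume f: "f \<in> order_maps Y (young_order l) {..1}"
    have mono: "f (i, j) \<le> f (i', j')"
      if "i \<le> i'" "j \<le> j'" "(i, j) \<in> Y" "(i', j') \<in> Y" for i j i' j'
      using f that by (auto simp: order_maps_def young_order_def Y_def)
    define Z where "Z i = {j. (i, j) \<in> Y \<and> f (i, j) = 0}" for i
    have Y_iff: "(i, j) \<in> Y \<longleftrightarrow> 1 \<le> i \<and> 1 \<le> j \<and> j \<le> part l i" for i j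
      by (simp add: Y_def young_diagram_def)
    have Z_sub: "Z i \<subseteq> {1..part l i}" for i
      by (auto simp: Z_def Y_iff)
    then have Z_fin: "finite (Z i)" for i
      by (rule finite_subset) simp
    have Z_card: "card (Z i) \<le> part l i" for i
      using card_mono[OF _ Z_sub, of i] by simp
    \<comment> \<open>Monotonicity along the row makes every box to the left of the last zero a
      zero, so \<open>Z i\<close> is determined by its size.\<close>
    have Z_eq: "Z i = {1..card (Z i)}" for i
    proof (cases "Z i = {}")
      case False
      define m where "m = Max (Z i)"
      have m: "m \<in> Z i" using False Z_fin by (simp add: m_def)
      have "Z i = {1..m}"
      proof (intro equalityI subsetI)
        fix j assume "j \<in> Z i"
        then show "j \<in> {1..m}" using Z_sub[of i] Z_fin by (auto simp: m_def)
      next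
        fix j assume j: "j \<in> {1..m}"
        then have "(i, j) \<in> Y" using m by (auto simp: Z_def Y_iff)
        then show "j \<in> Z i" using m mono[of i i j m] j by (auto simp: Z_def)
      qed
      then show ?thesis by simp
    qed simp
    \<comment> \<open>\<open>Suc\<close> reconciles list positions, counted from 0, with rows,
      counted from 1.\<close>
    define z where "z = map (\<lambda>i. card (Z (Suc i))) [0..<length l]"
    have part_z: "part z i = card (Z i)" if "1 \<le> i" for i
    proof (cases "i \<le> length l")
      case True
      then show ?thesis using that by (auto simp: part_def z_def)
    next
      \<comment> \<open>Below the diagram \<open>part\<close> defaults to 0, and \<open>Z i\<close>
        is empty because \<open>part l i\<close> bounds its size.\<close>
      case False
      then show ?thesis using Z_card[of i] by (auto simp: part_def z_def)
    qed
    have "z \<in> subpartitions l"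
    proof -
      have "z ! i \<le> l ! i" if "i < length l" for i
        using that Z_card[of "Suc i"] by (auto simp: z_def part_def)
      moreover have "card (Z (Suc i')) \<le> card (Z (Suc i))" if "i < i'" "i' < length l" for i i'
      proof (rule card_mono[OF Z_fin], rule subsetI)
        fix j assume j: "j \<in> Z (Suc i')"
        \<comment> \<open>Since \<open>l\<close> is weakly decreasing, the box above also lies in
          the diagram; monotonicity down the column then makes its value 0.\<close>
        then have "(Suc i, j) \<in> Y"
          using sorted_wrt_nth_less[OF l that] that by (auto simp: Z_def Y_iff part_def)
        then show "j \<in> Z (Suc i)" 
          using j mono[of "Suc i" "Suc i'" j j] that by (auto simp: Z_def)
      qed
      ultimately show ?thesis
        by (auto simp: subpartitions_def list_all2_conv_all_nth sorted_wrt_iff_nth_less z_def)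
    qed
    moreover have "h z = f"
    proof (rule extensionalityI[of _ Y])
      fix a assume "a \<in> Y"
      then obtain i j where a: "a = (i, j)" "(i, j) \<in> Y" by (cases a) auto
      have "f (i, j) \<le> 1" using f a by (auto simp: order_maps_def)
      moreover have "f (i, j) = 0 \<longleftrightarrow> j \<in> Z i" using a by (simp add: Z_def)
      moreover have "j \<in> Z i \<longleftrightarrow> j \<le> card (Z i)" using a by (subst Z_eq) (simp add: Y_iff)
      ultimately show "h z a = f a" using a part_z[of i] by (auto simp: h_def Y_iff)
    qed (use f in \<open>auto simp: h_def order_maps_def PiE_iff\<close>)
    ultimately show "f \<in> h ` subpartitions l" by blast
  qed
  ultimately show ?thesis by (metis card_image Y_def)
qed

section \<open>Counting subpartitions row by row\<close>

text \<open>The first argument carries the length of the preceding row, which bounds the next row;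
  \<open>c\<close> is the length chosen for the current one.\<close>

fun count_subpartitions :: "nat \<Rightarrow> nat list \<Rightarrow> nat" where
  "count_subpartitions b [] = 1"
| "count_subpartitions b (m # l) = sum_list (map (\<lambda>c. count_subpartitions c l) [0..<Suc (min b m)])"

text \<open>Induction over the rows. Finiteness is carried along because counting the disjoint union
  over the first part requires it.\<close>

lemma card_bounded_subpartitions:
  "finite {z \<in> subpartitions l. \<forall>c\<in>set z. c \<le> b}
    \<and> card {z \<in> subpartitions l. \<forall>c\<in>set z. c \<le> b} = count_subpartitions b l"
proof (induction l arbitrary: b)
  case Nil
  have "{z \<in> subpartitions []. \<forall>c\<in>set z. c \<le> b} = {[]}"
    by (auto simp: subpartitions_def)
  then show ?case by simp
next
  case (Cons m l)
  let ?S = "\<lambda>c. {z \<in> subpartitions l. \<forall>d\<in>set z. d \<le> c}"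
  \<comment> \<open>Once the first part is \<open>c\<close>, being weakly decreasing means exactly
    that the tail is weakly decreasing with entries at most \<open>c\<close>.\<close>
  have eq: "{z \<in> subpartitions (m # l). \<forall>c\<in>set z. c \<le> b} = (\<Union>c\<in>{..min b m}. (#) c ` ?S c)"
    by (fastforce simp: subpartitions_def list_all2_Cons2)
  have "card (\<Union>c\<in>{..min b m}. (#) c ` ?S c) = (\<Sum>c\<le>min b m. card ((#) c ` ?S c))"
    using Cons.IH by (intro card_UN_disjoint) auto
  also have "\<dots> = (\<Sum>c\<le>min b m. count_subpartitions c l)"
    using Cons.IH by (simp add: card_image)
  also have "\<dots> = count_subpartitions b (m # l)"
    by (simp add: interv_sum_list_conv_sum_set_nat atLeast0LessThan lessThan_Suc_atMost
        del: upt_Suc)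
  finally show ?case using Cons.IH by (simp add: eq del: count_subpartitions.simps)
qed

text \<open>An upper bound for the parts of \<open>l\<close> also bounds every subpartition, so the
  restriction by \<open>b\<close> excludes nothing.\<close>

lemma card_subpartitions:
  assumes "\<forall>m\<in>set l. m \<le> b"
  shows "card (subpartitions l) = count_subpartitions b l"
proof -
  have "\<forall>c\<in>set z. c \<le> b" if "z \<in> subpartitions l" for z
  proof
    fix c assume "c \<in> set z"
    then obtain i where i: "i < length z" "c = z ! i"
      by (auto simp: in_set_conv_nth)
    then have "i < length l" "z ! i \<le> l ! i"
      using that by (auto simp: subpartitions_def list_all2_conv_all_nth)
    moreover from this have "l ! i \<le> b" using assms by simp
    ultimately show "c \<le> b" using i by simp
  qed
  then have "{z \<in> subpartitions l. \<forall>c\<in>set z. c \<le> b} = subpartitions l" by blast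
  then show ?thesis using card_bounded_subpartitions[of l b] by simp
qed

lemma poly_ehrhart_polynomial_young_1:
  assumes "sorted_wrt (\<ge>) l" "\<forall>m\<in>set l. m \<le> b"
  shows "poly (ehrhart_polynomial (order_polytope (young_diagram l) (young_order l))) 1
    = real (count_subpartitions b l)"
proof -
  have "young_order l \<subseteq> young_diagram l \<times> young_diagram l"
    by (auto simp: young_order_def)
  then show ?thesis
    using assms by (simp add: poly_ehrhart_polynomial_1 finite_young_diagram card_order_maps_young
        card_subpartitions del: One_nat_def)
qed

section \<open>Evaluating hook multisets\<close>

text \<open>Replaces a cardinality by a list computation that can be evaluated on concrete
  partitions; row indices are list positions shifted by one.\<close>

lemma conj_part_code: "conj_part l j = length (filter (\<lambda>m. j \<le> m) l)"
proof -
  have "i \<in> Suc ` {i. i < length l \<and> j \<le> l ! i}" if "1 \<le> i" "i \<le> length l" "j \<le> part l i" for i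
    using that by (intro image_eqI[of _ _ "i - 1"]) (auto simp: part_def)
  then have "{i. 1 \<le> i \<and> i \<le> length l \<and> j \<le> part l i} = Suc ` {i. i < length l \<and> j \<le> l ! i}"
    by (auto simp: part_def)
  then show ?thesis
    by (simp add: conj_part_def card_image length_filter_conv_card)
qed

lemma distinct_concat_map_Pair:
  "distinct is \<Longrightarrow> (\<And>i. distinct (f i)) \<Longrightarrow> distinct (concat (map (\<lambda>i. map (Pair i) (f i)) is))"
  by (induction "is") (auto simp: distinct_map inj_on_def)

text \<open>The boxes are listed row by row without repetition, so each contributes its hook exactly
  once and the multiset becomes computable.\<close>

lemma hook_multiset_code:
  "hook_multiset l
    = mset (map (hook l) (concat (map (\<lambda>i. map (Pair i) [1..<Suc (part l i)]) [1..<Suc (length l)])))"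
    (is "_ = mset (map _ ?b)")
proof -
  have "young_diagram l = set ?b"
    by (auto simp: young_diagram_def part_def image_iff simp del: upt_Suc split: if_splits)
  moreover have "distinct ?b"
    by (intro distinct_concat_map_Pair distinct_upt)
  ultimately show ?thesis
    by (simp only: hook_multiset_def mset_set_set mset_map)
qed

theorem mainTheorem3:
  fixes lam mu :: "nat list"
  assumes "lam = [8, 5, 4]" and "mu = [7, 7, 2, 1]"
  shows "hook_multiset lam = hook_multiset mu
    \<and> ehrhart_polynomial (order_polytope (young_diagram lam) (young_order lam))
        \<noteq> ehrhart_polynomial (order_polytope (young_diagram mu) (young_order mu))"
proof
  show "hook_multiset lam = hook_multiset mu"
    \<comment> \<open>Both diagrams have 17 boxes, and the hooks are written out and compared
      explicitly.\<close>
    by (simp add: hook_multiset_code conj_part_code part_def assms upt_rec)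
next
  \<comment> \<open>The bounds 8 and 7 are the largest parts. The results are the numbers of order
    ideals of the two posets.\<close>
  have "count_subpartitions 8 [8, 5, 4] = 115" "count_subpartitions 7 [7, 7, 2, 1] = 134"
    by code_simp+
  then have "poly (ehrhart_polynomial (order_polytope (young_diagram lam) (young_order lam))) 1 = 115"
    "poly (ehrhart_polynomial (order_polytope (young_diagram mu) (young_order mu))) 1 = 134"
    using poly_ehrhart_polynomial_young_1[of lam 8] poly_ehrhart_polynomial_young_1[of mu 7]
    by (simp_all add: assms)
  then show "ehrhart_polynomial (order_polytope (young_diagram lam) (young_order lam))
      \<noteq> ehrhart_polynomial (order_polytope (young_diagram mu) (young_order mu))"
    by auto
qed

end
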